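(* Let $A$ be a finite alphabet with $|A|\geq 2$ and let $\Gamma$ be a finitely generated group. The full $\Gamma$-shift $A^\Gamma$ is effective if and only if $\Gamma$ is recursively presented.
   Context: A finitely generated group is recursively presented if for some (equivalently, any) finite symmetric generating set $S$ the set of words in $S^*$ representing the identity is recursively enumerable. $\Gamma$ acts on $A^\Gamma$ (prodiscrete topology) by $(gx)(h)=x(g^{-1}h)$; a $\Gamma$-subshift is a closed $\Gamma$-invariant subset; $A^\Gamma$ itself is the full $\Gamma$-shift. Let $S$ be a finite generating set of $\Gamma$, $F(S)$ the free group on $S$, $\phi\colon F(S)\to\Gamma$ the canonical epimorphism. The pullback of a subshift $X\subset A^\Gamma$ is $\widehat X=\{x\circ\phi:x\in X\}\subset A^{F(S)}$. $X$ is effective if for some (equivalently any) finite generating set $S$ the set $\widehat X$ is effectively closed in $A^{F(S)}$, i.e. the set of patterns $p\colon W\to A$, $W\subset F(S)$ finite, such that no $y\in\widehat X$ satisfies $y|_W=p$ is recursively enumerable. *)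

theory Defs
  imports
    "HOL-Library.FuncSet"
    "HOL-Library.Nat_Bijection"
    "HOL-Analysis.Function_Topology"
    "HOL-Algebra.Generated_Groups"
begin

section \<open>Recursively enumerable sets\<close>

text \<open>
  \<open>recursive n f\<close>: the function sending \<open>(x\<^sub>1, \<dots>, x\<^sub>n)\<close> to \<open>f [x\<^sub>1, \<dots>, x\<^sub>n]\<close> is a total
  recursive function of arity \<open>n\<close>.  This is Kleene's definition of the general recursive
  functions: minimisation is applied only to regular functions, so no partial functions occur.
  By rule \<open>cong\<close> the values of \<open>f\<close> on lists of any other length are irrelevant.
\<close>

inductive recursive :: "nat \<Rightarrow> (nat list \<Rightarrow> nat) \<Rightarrow> bool" where
  zero: "recursive n (\<lambda>xs. 0)"
| succ: "recursive 1 (\<lambda>xs. Suc (hd xs))"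
| proj: "i < n \<Longrightarrow> recursive n (\<lambda>xs. xs ! i)"
| comp: "recursive (length fs) g \<Longrightarrow> (\<And>f. f \<in> set fs \<Longrightarrow> recursive n f) \<Longrightarrow>
    recursive n (\<lambda>xs. g (map (\<lambda>f. f xs) fs))"
| prim_rec: "recursive n g \<Longrightarrow> recursive (Suc (Suc n)) h \<Longrightarrow>
    recursive (Suc n) (\<lambda>xs. rec_nat (g (tl xs)) (\<lambda>k r. h (k # r # tl xs)) (hd xs))"
| mu: "recursive (Suc n) g \<Longrightarrow> (\<And>xs. length xs = n \<Longrightarrow> \<exists>k. g (k # xs) = 0) \<Longrightarrow>
    recursive n (\<lambda>xs. LEAST k. g (k # xs) = 0)"
| cong: "recursive n f \<Longrightarrow> (\<And>xs. length xs = n \<Longrightarrow> f xs = g xs) \<Longrightarrow> recursive n g"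

definition recursively_enumerable :: "nat set \<Rightarrow> bool" where
  "recursively_enumerable E \<longleftrightarrow>
    E = {} \<or> (\<exists>f. recursive 1 f \<and> E = range (\<lambda>k. f [k]))"

text \<open>
  Sets of words, patterns, etc.\ over a finite alphabet are called recursively enumerable if
  their sets of codes are.  Letters are coded through a numbering of the alphabet; two numberings
  differ by a permutation of a finite set, so the choice does not matter.
\<close>

definition numbering :: "'a set \<Rightarrow> ('a \<Rightarrow> nat) \<Rightarrow> bool" where
  "numbering S c \<longleftrightarrow> bij_betw c S {..<card S}"


section \<open>Recursively presented groups\<close>

definition word_value :: "('g, 'm) monoid_scheme \<Rightarrow> 'g list \<Rightarrow> 'g" where
  "word_value G w = foldr (mult G) w (one G)"

definition generating_set :: "('g, 'm) monoid_scheme \<Rightarrow> 'g set \<Rightarrow> bool" where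
  "generating_set G S \<longleftrightarrow> S \<subseteq> carrier G \<and> generate G S = carrier G"

definition symmetric_set :: "('g, 'm) monoid_scheme \<Rightarrow> 'g set \<Rightarrow> bool" where
  "symmetric_set G S \<longleftrightarrow> (\<forall>s \<in> S. m_inv G s \<in> S)"

definition finitely_generated :: "('g, 'm) monoid_scheme \<Rightarrow> bool" where
  "finitely_generated G \<longleftrightarrow> (\<exists>S. finite S \<and> generating_set G S)"

definition word_problem :: "('g, 'm) monoid_scheme \<Rightarrow> 'g set \<Rightarrow> 'g list set" where
  "word_problem G S = {w \<in> lists S. word_value G w = one G}"

definition re_language :: "'s set \<Rightarrow> 's list set \<Rightarrow> bool" where
  "re_language S L \<longleftrightarrow>
    (\<exists>c. numbering S c \<and> recursively_enumerable ((\<lambda>w. list_encode (map c w)) ` L))"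

definition recursively_presented :: "('g, 'm) monoid_scheme \<Rightarrow> bool" where
  "recursively_presented G \<longleftrightarrow>
    (\<exists>S. finite S \<and> generating_set G S \<and> symmetric_set G S \<and> re_language S (word_problem G S))"


section \<open>Free groups\<close>

text \<open>
  The elements of the free group on \<open>S\<close> are the reduced words in the letters \<open>(s, True)\<close>, standing
  for \<open>s\<close>, and \<open>(s, False)\<close>, standing for the formal inverse of \<open>s\<close>.
\<close>

type_synonym 's letter = "'s \<times> bool"

fun inv_letter :: "'s letter \<Rightarrow> 's letter" where
  "inv_letter (s, b) = (s, \<not> b)"

definition reduced :: "'s letter list \<Rightarrow> bool" where
  "reduced w \<longleftrightarrow> successively (\<lambda>x y. y \<noteq> inv_letter x) w"

fun reduced_cons :: "'s letter \<Rightarrow> 's letter list \<Rightarrow> 's letter list" where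
  "reduced_cons x [] = [x]"
| "reduced_cons x (y # w) = (if y = inv_letter x then w else x # y # w)"

definition free_group :: "'s set \<Rightarrow> 's letter list monoid" where
  "free_group S =
    \<lparr>carrier = {w \<in> lists (S \<times> UNIV). reduced w}, mult = foldr reduced_cons, one = []\<rparr>"

definition letter_value :: "('g, 'm) monoid_scheme \<Rightarrow> 'g letter \<Rightarrow> 'g" where
  "letter_value G x = (if snd x then fst x else m_inv G (fst x))"

definition canonical_epi :: "('g, 'm) monoid_scheme \<Rightarrow> 'g letter list \<Rightarrow> 'g" where
  "canonical_epi G w = word_value G (map (letter_value G) w)"

lemma inv_letter_inv_letter [simp]: "inv_letter (inv_letter x) = x"
  by (cases x) simp

lemma reduced_Nil [simp]: "reduced []"
  by (simp add: reduced_def)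

lemma reduced_Cons: "reduced (x # w) \<longleftrightarrow> reduced w \<and> (w = [] \<or> hd w \<noteq> inv_letter x)"
  by (cases w) (auto simp: reduced_def)

lemma reduced_reduced_cons: "reduced w \<Longrightarrow> reduced (reduced_cons x w)"
  by (cases w) (auto simp: reduced_Cons)

lemma reduced_cons_cancel: "reduced w \<Longrightarrow> reduced_cons (inv_letter x) (reduced_cons x w) = w"
  by (cases w rule: remdups_adj.cases) (auto simp: reduced_Cons)

lemma reduced_cons_cancel': "reduced w \<Longrightarrow> reduced_cons x (reduced_cons (inv_letter x) w) = w"
  using reduced_cons_cancel[of w "inv_letter x"] by simp

lemma reduced_foldr: "reduced v \<Longrightarrow> reduced (foldr reduced_cons u v)"
  by (induction u) (auto intro: reduced_reduced_cons)

lemma foldr_reduced_cons_assoc: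
  "reduced w \<Longrightarrow> foldr reduced_cons (foldr reduced_cons u v) w =
    foldr reduced_cons u (foldr reduced_cons v w)"
proof (induction u)
  case (Cons x u)
  have "foldr reduced_cons (reduced_cons x t) w = reduced_cons x (foldr reduced_cons t w)" for t
    by (cases t) (auto simp: reduced_cons_cancel' reduced_foldr Cons.prems)
  with Cons show ?case by simp
qed simp

lemma foldr_reduced_cons_Nil: "reduced w \<Longrightarrow> foldr reduced_cons w [] = w"
proof (induction w)
  case (Cons x w)
  then show ?case by (cases w) (auto simp: reduced_Cons)
qed simp

lemma reduced_cons_lists:
  "x \<in> S \<times> UNIV \<Longrightarrow> w \<in> lists (S \<times> UNIV) \<Longrightarrow> reduced_cons x w \<in> lists (S \<times> UNIV)"
  by (cases w) auto

lemma foldr_reduced_cons_lists: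
  "u \<in> lists (S \<times> UNIV) \<Longrightarrow> w \<in> lists (S \<times> UNIV) \<Longrightarrow>
    foldr reduced_cons u w \<in> lists (S \<times> UNIV)"
  by (induction u) (simp_all del: in_lists_conv_set add: reduced_cons_lists)

lemma foldr_reduced_cons_inverse:
  "reduced w \<Longrightarrow> foldr reduced_cons (rev (map inv_letter u)) (foldr reduced_cons u w) = w"
  by (induction u arbitrary: w) (auto simp: reduced_cons_cancel reduced_foldr)

lemma group_free_group: "group (free_group S)"
proof (rule groupI)
  fix w assume w: "w \<in> carrier (free_group S)"
  let ?v = "foldr reduced_cons (rev (map inv_letter w)) []"
  have "rev (map inv_letter w) \<in> lists (S \<times> UNIV)"
    using w by (fastforce simp: free_group_def)
  then have "?v \<in> carrier (free_group S)"
    by (simp add: free_group_def reduced_foldr foldr_reduced_cons_lists del: in_lists_conv_set)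
  moreover have "foldr reduced_cons ?v w = []"
    using w foldr_reduced_cons_inverse[of "[]" w]
    by (auto simp: free_group_def foldr_reduced_cons_assoc foldr_reduced_cons_Nil)
  ultimately show "\<exists>v \<in> carrier (free_group S). v \<otimes>\<^bsub>free_group S\<^esub> w = \<one>\<^bsub>free_group S\<^esub>"
    by (auto simp: free_group_def)
qed (simp_all add: free_group_def reduced_foldr foldr_reduced_cons_assoc
      foldr_reduced_cons_lists del: in_lists_conv_set)

context group
begin

lemma letter_value_closed: "S \<subseteq> carrier G \<Longrightarrow> x \<in> S \<times> UNIV \<Longrightarrow> letter_value G x \<in> carrier G"
  by (auto simp: letter_value_def)

lemma canonical_epi_Nil: "canonical_epi G [] = \<one>"
  by (simp add: canonical_epi_def word_value_def)

lemma canonical_epi_Cons: "canonical_epi G (x # w) = letter_value G x \<otimes> canonical_epi G w"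
  by (simp add: canonical_epi_def word_value_def)

lemma canonical_epi_closed:
  "S \<subseteq> carrier G \<Longrightarrow> w \<in> lists (S \<times> UNIV) \<Longrightarrow> canonical_epi G w \<in> carrier G"
  by (induction w) (auto simp: canonical_epi_Nil canonical_epi_Cons letter_value_closed)

lemma letter_value_inv:
  "fst x \<in> carrier G \<Longrightarrow> letter_value G x \<otimes> letter_value G (inv_letter x) = \<one>"
  by (cases x) (auto simp: letter_value_def)

lemma canonical_epi_reduced_cons:
  assumes "S \<subseteq> carrier G" "x \<in> S \<times> UNIV" "w \<in> lists (S \<times> UNIV)"
  shows "canonical_epi G (reduced_cons x w) = letter_value G x \<otimes> canonical_epi G w"
proof (cases w)
  case (Cons y v)
  have mem: "letter_value G x \<in> carrier G" "letter_value G y \<in> carrier G"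
      "canonical_epi G v \<in> carrier G" "fst x \<in> carrier G"
    using assms Cons by (auto intro: letter_value_closed canonical_epi_closed)
  then show ?thesis
    using Cons letter_value_inv[of x] by (auto simp: canonical_epi_Cons simp flip: m_assoc)
qed (simp add: canonical_epi_Cons canonical_epi_Nil)

text \<open>
  The next two facts characterise \<open>canonical_epi\<close> on the free group: it is the homomorphism that
  extends the inclusion of \<open>S\<close>.
\<close>

lemma canonical_epi_hom:
  assumes S: "S \<subseteq> carrier G"
  shows "canonical_epi G \<in> hom (free_group S) G"
proof (rule homI)
  fix u v assume "u \<in> carrier (free_group S)" "v \<in> carrier (free_group S)"
  then have u: "u \<in> lists (S \<times> UNIV)" and v: "v \<in> lists (S \<times> UNIV)"
    by (auto simp: free_group_def)
  from u have "canonical_epi G (foldr reduced_cons u v) = canonical_epi G u \<otimes> canonical_epi G v"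
  proof (induction u)
    case Nil
    show ?case using canonical_epi_closed[OF S v] by (simp add: canonical_epi_Nil)
  next
    case (Cons x u)
    then have "foldr reduced_cons u v \<in> lists (S \<times> UNIV)" "x \<in> S \<times> UNIV"
      using foldr_reduced_cons_lists[OF _ v] by auto
    then show ?case
      using Cons S canonical_epi_closed[OF S v] canonical_epi_closed[OF S, of u]
        letter_value_closed[OF S, of x]
      by (simp add: canonical_epi_reduced_cons canonical_epi_Cons m_assoc)
  qed
  then show "canonical_epi G (u \<otimes>\<^bsub>free_group S\<^esub> v) = canonical_epi G u \<otimes> canonical_epi G v"
    by (simp add: free_group_def)
qed (auto simp: free_group_def intro!: canonical_epi_closed[OF S])

lemma canonical_epi_generator: "s \<in> carrier G \<Longrightarrow> canonical_epi G [(s, True)] = s"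
  by (simp add: canonical_epi_Cons canonical_epi_Nil letter_value_def)

lemma canonical_epi_surj:
  assumes "generating_set G S"
  shows "canonical_epi G ` carrier (free_group S) = carrier G"
proof
  have S: "S \<subseteq> carrier G" and gen: "generate G S = carrier G"
    using assms by (auto simp: generating_set_def)
  interpret \<phi>: group_hom "free_group S" G "canonical_epi G"
    by (intro group_hom.intro group_hom_axioms.intro group_free_group canonical_epi_hom[OF S]
        group_axioms)
  show "canonical_epi G ` carrier (free_group S) \<subseteq> carrier G" by auto
  have "S \<subseteq> canonical_epi G ` carrier (free_group S)"
  proof
    fix s assume "s \<in> S"
    then show "s \<in> canonical_epi G ` carrier (free_group S)"
      using S canonical_epi_generator[of s]
      by (intro image_eqI[of _ _ "[(s, True)]"]) (auto simp: free_group_def reduced_Cons)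
  qed
  with \<phi>.img_is_subgroup gen
  show "carrier G \<subseteq> canonical_epi G ` carrier (free_group S)"
    using generate_subgroup_incl[of S "canonical_epi G ` carrier (free_group S)"] by simp
qed

end


section \<open>Subshifts\<close>

definition full_shift :: "('g, 'm) monoid_scheme \<Rightarrow> 'a set \<Rightarrow> ('g \<Rightarrow> 'a) set" where
  "full_shift G A = carrier G \<rightarrow>\<^sub>E A"

definition prodiscrete_topology ::
  "('g, 'm) monoid_scheme \<Rightarrow> 'a set \<Rightarrow> ('g \<Rightarrow> 'a) topology" where
  "prodiscrete_topology G A = product_topology (\<lambda>_. discrete_topology A) (carrier G)"

definition shift_action :: "('g, 'm) monoid_scheme \<Rightarrow> 'g \<Rightarrow> ('g \<Rightarrow> 'a) \<Rightarrow> 'g \<Rightarrow> 'a" where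
  "shift_action G g x = (\<lambda>h \<in> carrier G. x (mult G (m_inv G g) h))"

definition subshift :: "('g, 'm) monoid_scheme \<Rightarrow> 'a set \<Rightarrow> ('g \<Rightarrow> 'a) set \<Rightarrow> bool" where
  "subshift G A X \<longleftrightarrow> closedin (prodiscrete_topology G A) X \<and>
    (\<forall>g \<in> carrier G. \<forall>x \<in> X. shift_action G g x \<in> X)"

lemma (in group) subshift_full_shift: "subshift G A (full_shift G A)"
proof -
  have "closedin (prodiscrete_topology G A) (full_shift G A)"
    using closedin_topspace[of "prodiscrete_topology G A"]
    by (simp add: prodiscrete_topology_def full_shift_def)
  then show ?thesis
    by (auto simp: subshift_def full_shift_def shift_action_def PiE_iff)
qed

definition pullback ::
  "('g, 'm) monoid_scheme \<Rightarrow> 'g set \<Rightarrow> ('g \<Rightarrow> 'a) set \<Rightarrow> ('g letter list \<Rightarrow> 'a) set" where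
  "pullback G S X = (\<lambda>x. compose (carrier (free_group S)) x (canonical_epi G)) ` X"

text \<open>A pattern \<open>p: W \<rightarrow> A\<close> is represented by a partial function with domain \<open>W\<close>.\<close>

definition patterns :: "'s set \<Rightarrow> 'a set \<Rightarrow> ('s letter list \<rightharpoonup> 'a) set" where
  "patterns S A = {p. finite (dom p) \<and> dom p \<subseteq> carrier (free_group S) \<and> ran p \<subseteq> A}"

definition forbidden_patterns ::
  "'s set \<Rightarrow> 'a set \<Rightarrow> ('s letter list \<Rightarrow> 'a) set \<Rightarrow> ('s letter list \<rightharpoonup> 'a) set" where
  "forbidden_patterns S A Y =
    {p \<in> patterns S A. \<not> (\<exists>y \<in> Y. \<forall>w \<in> dom p. p w = Some (y w))}"

definition letter_code :: "('s \<Rightarrow> nat) \<Rightarrow> 's letter \<Rightarrow> nat" where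
  "letter_code c x = prod_encode (c (fst x), of_bool (snd x))"

text \<open>A pattern is coded by its graph, a finite set of pairs (word, letter).\<close>

definition pattern_code ::
  "('s \<Rightarrow> nat) \<Rightarrow> ('a \<Rightarrow> nat) \<Rightarrow> ('s letter list \<rightharpoonup> 'a) \<Rightarrow> nat" where
  "pattern_code c d p =
    set_encode ((\<lambda>(w, a). prod_encode (list_encode (map (letter_code c) w), d a)) ` Map.graph p)"

definition effectively_closed :: "'s set \<Rightarrow> 'a set \<Rightarrow> ('s letter list \<Rightarrow> 'a) set \<Rightarrow> bool" where
  "effectively_closed S A Y \<longleftrightarrow>
    (\<exists>c d. numbering S c \<and> numbering A d \<and>
      recursively_enumerable (pattern_code c d ` forbidden_patterns S A Y))"

definition effective_subshift ::
  "('g, 'm) monoid_scheme \<Rightarrow> 'a set \<Rightarrow> ('g \<Rightarrow> 'a) set \<Rightarrow> bool" where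
  "effective_subshift G A X \<longleftrightarrow> subshift G A X \<and>
    (\<exists>S. finite S \<and> generating_set G S \<and> effectively_closed S A (pullback G S X))"

end

theory Submission
  imports Defs
begin

text \<open>
  A pattern is forbidden in the pullback of the full shift iff it assigns different letters to two
  words \<open>u\<close>, \<open>v\<close> of the free group with \<open>\<phi> u = \<phi> v\<close>, i.e. with \<open>u\<inverse> v\<close> in the word problem.  This
  enumerates the forbidden patterns from the word problem.  Conversely, for two distinct letters
  \<open>a\<close>, \<open>b\<close>, a word with nonempty free reduction \<open>r\<close> represents the identity iff the pattern
  \<open>r \<mapsto> a, [] \<mapsto> b\<close> is forbidden.
\<close>

section \<open>Computable functions on the natural numbers\<close>

text \<open>The two directions use different generating sets. From a recursive presentation the
  given symmetric \<open>S\<close> is kept: the unreduced word for u^-1 v is already a word over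
  \<open>S\<close>, and the word problem contains arbitrary words. In the converse, the
  \<open>S\<close> that witnesses effectiveness may fail to be symmetric, so the word problem is
  taken over the values of all its formal letters. Words over that set are lifted to the free group
  and freely reduced, since patterns live on reduced words. The empty reduction is a separate case
  because both entries of the two-point pattern would then sit at the same word. As recursive
  enumerability rests on Kleene's recursive functions, every algorithm has to become arithmetic on
  codes. A recursively enumerable set is handled as the projection of a decidable relation, so that
  the things to be searched for (a pair of conflicting entries, a stage of an enumeration) become
  one existential witness. The group enters the algorithms only through finite tables on letters,
  which are computable for any group, and through the set assumed to be enumerable.\<close>

definition computable :: "(nat \<Rightarrow> nat) \<Rightarrow> bool" where
  "computable f \<longleftrightarrow> recursive 1 (\<lambda>xs. f (hd xs))"

definition computable2 :: "(nat \<Rightarrow> nat \<Rightarrow> nat) \<Rightarrow> bool" where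
  "computable2 f \<longleftrightarrow> recursive 2 (\<lambda>xs. f (xs ! 0) (xs ! 1))"

lemma recursive_comp1:
  "computable f \<Longrightarrow> recursive n g \<Longrightarrow> recursive n (\<lambda>xs. f (g xs))"
  using recursive.comp[of "[g]" "\<lambda>xs. f (hd xs)" n] by (simp add: computable_def)

lemma recursive_comp2:
  "computable2 f \<Longrightarrow> recursive n g \<Longrightarrow> recursive n h \<Longrightarrow> recursive n (\<lambda>xs. f (g xs) (h xs))"
  using recursive.comp[of "[g, h]" "\<lambda>xs. f (xs ! 0) (xs ! 1)" n]
  by (auto simp: computable2_def numeral_2_eq_2)

lemma computable_comp2:
  "computable2 f \<Longrightarrow> computable g \<Longrightarrow> computable h \<Longrightarrow> computable (\<lambda>x. f (g x) (h x))"
  unfolding computable_def by (rule recursive_comp2)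

lemma computable_comp: "computable f \<Longrightarrow> computable g \<Longrightarrow> computable (\<lambda>x. f (g x))"
  using recursive_comp1[of f 1 "\<lambda>xs. g (hd xs)"] by (simp add: computable_def)

lemma computable_const [intro]: "computable (\<lambda>x. k)"
proof -
  have "recursive n (\<lambda>xs. k)" for n
  proof (induction k)
    case (Suc k)
    have "computable Suc" unfolding computable_def by (rule recursive.succ)
    from recursive_comp1[OF this Suc] show ?case .
  qed (rule recursive.zero)
  then show ?thesis by (simp add: computable_def)
qed

lemma computable_id: "computable (\<lambda>x. x)"
  unfolding computable_def
  by (rule recursive.cong[OF recursive.proj[of 0 1]]) (auto simp: length_Suc_conv)

lemma computable_Suc: "computable f \<Longrightarrow> computable (\<lambda>x. Suc (f x))"
  by (rule computable_comp[of Suc]) (simp_all only: computable_def recursive.succ)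

lemma computable2_rec_nat:
  assumes "computable g" "recursive 3 (\<lambda>xs. h (xs ! 0) (xs ! 1) (xs ! 2))"
  shows "computable2 (\<lambda>n a. rec_nat (g a) (\<lambda>k r. h k r a) n)"
proof -
  have "recursive (Suc 1)
      (\<lambda>xs. rec_nat (g (hd (tl xs))) (\<lambda>k r. h ((k # r # tl xs) ! 0) ((k # r # tl xs) ! 1)
        ((k # r # tl xs) ! 2)) (hd xs))"
    using assms by (intro recursive.prim_rec) (simp_all add: computable_def numeral_3_eq_3)
  then have "recursive 2
      (\<lambda>xs. rec_nat (g (hd (tl xs))) (\<lambda>k r. h k r (hd (tl xs))) (hd xs))"
    unfolding Suc_1 by (rule recursive.cong) (auto simp: length_Suc_conv numeral_2_eq_2)
  then show ?thesis
    unfolding computable2_def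
    by (rule recursive.cong) (auto simp: length_Suc_conv numeral_2_eq_2)
qed

lemma computable2_flip: "computable2 f \<Longrightarrow> computable2 (\<lambda>x y. f y x)"
  unfolding computable2_def
  using recursive_comp2[of f 2 "\<lambda>xs. xs ! 1" "\<lambda>xs. xs ! 0"]
  by (simp add: recursive.proj computable2_def)

lemma computable2_funpow:
  assumes "computable s"
  shows "computable2 (\<lambda>n a. (s ^^ n) a)"
proof -
  have eq: "rec_nat a (\<lambda>k. s) n = (s ^^ n) a" for a n
    by (induction n) auto
  have "computable2 (\<lambda>n a. rec_nat a (\<lambda>k r. s r) n)"
    by (intro computable2_rec_nat recursive_comp1[OF assms] recursive.proj computable_id) auto
  then show ?thesis by (simp add: eq)
qed

section \<open>Elementary arithmetic\<close>

lemma computable2_add: "computable2 (+)"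
proof -
  have "(Suc ^^ n) a = n + a" for n a by (induction n) auto
  with computable2_funpow[OF computable_Suc[OF computable_id]] show ?thesis by simp
qed

lemma computable2_mult: "computable2 (*)"
proof -
  have eq: "rec_nat 0 (\<lambda>k r. r + a) n = n * a" for a n :: nat
    by (induction n) auto
  have "computable2 (\<lambda>n a. rec_nat 0 (\<lambda>k r. r + a) n)"
    by (intro computable2_rec_nat recursive_comp2[OF computable2_add] recursive.proj) auto
  then show ?thesis by (simp add: eq)
qed

lemma computable2_diff: "computable2 (-)"
proof -
  \<comment> \<open>Returning the counter and ignoring the accumulator gives the predecessor, with
    value 0 at 0. Iterating it yields truncated subtraction.\<close>
  have "computable2 (\<lambda>n a. rec_nat 0 (\<lambda>k r. k) n)"
    by (intro computable2_rec_nat recursive.proj) auto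
  then have "computable (\<lambda>n. rec_nat 0 (\<lambda>k r. k) n)"
    using computable_comp2[of "\<lambda>n a. rec_nat 0 (\<lambda>k r. k) n"] computable_id by blast
  moreover have "rec_nat 0 (\<lambda>k r. k) n = n - 1" for n :: nat by (cases n) auto
  ultimately have "computable (\<lambda>n. n - 1)" by simp
  moreover have "((\<lambda>n. n - 1) ^^ n) a = a - n" for n a :: nat by (induction n) auto
  ultimately have "computable2 (\<lambda>n a. a - n)"
    using computable2_funpow[of "\<lambda>n. n - 1"] by simp
  then show ?thesis by (rule computable2_flip)
qed

lemma computable2_power: "computable2 (^)"
proof -
  have eq: "rec_nat 1 (\<lambda>k r. a * r) n = a ^ n" for a n :: nat
    by (induction n) auto
  have "computable2 (\<lambda>n a. rec_nat 1 (\<lambda>k r. a * r) n)"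
    by (intro computable2_rec_nat recursive_comp2[OF computable2_mult] recursive.proj) auto
  then show ?thesis unfolding eq by (rule computable2_flip)
qed

lemmas computable_add = computable_comp2[OF computable2_add]
lemmas computable_mult = computable_comp2[OF computable2_mult]
lemmas computable_diff = computable_comp2[OF computable2_diff]
lemmas computable_power = computable_comp2[OF computable2_power]

lemma computable_LEAST2:
  assumes "computable2 f" "\<And>x. \<exists>k. f k x = 0"
  shows "computable (\<lambda>x. LEAST k. f k x = 0)"
proof -
  have "recursive 1 (\<lambda>xs. LEAST k. f ((k # xs) ! 0) ((k # xs) ! 1) = 0)"
    using assms by (intro recursive.mu) (auto simp: computable2_def numeral_2_eq_2)
  then show ?thesis
    unfolding computable_def
    by (rule recursive.cong) (auto simp: length_Suc_conv)
qed

section \<open>The pairing function and its inverse\<close>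

lemma computable2_prod_encode: "computable2 (\<lambda>x y. prod_encode (x, y))"
proof -
  have eq: "rec_nat 0 (\<lambda>k r. r + Suc k) n = triangle n" for n
    by (induction n) auto
  have "computable2 (\<lambda>n a. rec_nat 0 (\<lambda>k r. r + Suc k) n)"
    by (intro computable2_rec_nat recursive_comp2[OF computable2_add] recursive.proj
        recursive_comp1[OF computable_Suc[OF computable_id]] computable_const) auto
  then have t: "computable triangle"
    using computable_comp2[of "\<lambda>n a. triangle n"] computable_id unfolding eq by blast
  show ?thesis
    unfolding computable2_def prod_encode_def prod.case
    by (intro recursive_comp2[OF computable2_add] recursive_comp1[OF t] recursive.proj) auto
qed

text \<open>Pairs are numbered along diagonals, and the codes on diagonal \<open>s\<close> are
  \<open>triangle s\<close>, ..., \<open>triangle s + s\<close>. So the diagonal of \<open>z\<close>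
  is the least \<open>s\<close> with \<open>z < triangle (Suc s)\<close>; truncated subtraction
  turns this inequality into an equation with 0, the form that minimisation accepts.\<close>

lemma prod_decode_triangle:
  fixes z :: nat
  defines "s \<equiv> LEAST s. Suc z - triangle (Suc s) = 0"
  shows "prod_decode z = (z - triangle s, s - (z - triangle s))"
proof -
  obtain m n where mn: "prod_decode z = (m, n)" by fastforce
  then have "z = prod_encode (m, n)"
    using prod_decode_inverse[of z] by simp
  then have z: "z = triangle (m + n) + m"
    by (simp add: prod_encode_def)
  have mono: "triangle i \<le> triangle j" if "i \<le> j" for i j
    using that by (induction rule: dec_induct) auto
  have "s = m + n"
    unfolding s_def
  proof (rule Least_equality)
    fix y assume "Suc z - triangle (Suc y) = 0"
    then show "m + n \<le> y"
      using mono[of "Suc y" "m + n"] z by (cases "m + n \<le> y") auto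
  qed (simp add: z)
  then show ?thesis unfolding mn by (simp add: z)
qed

lemma computable_prod_decode:
  shows computable_fst_prod_decode: "computable f \<Longrightarrow> computable (\<lambda>x. fst (prod_decode (f x)))"
    and computable_snd_prod_decode: "computable f \<Longrightarrow> computable (\<lambda>x. snd (prod_decode (f x)))"
proof -
  have t: "computable triangle"
  proof -
    have "computable (\<lambda>n. prod_encode (0, n))"
      by (intro computable_comp2[OF computable2_prod_encode] computable_id computable_const)
    then show ?thesis by (simp add: prod_encode_def)
  qed
  have "triangle (Suc k) > k" for k by (induction k) auto
  then have ex: "\<exists>k. Suc x - triangle (Suc k) = 0" for x
    by (intro exI[of _ x]) (simp add: Suc_le_eq)
  have "computable2 (\<lambda>k x. Suc x - triangle (Suc k))"
    unfolding computable2_def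
    by (intro recursive_comp2[OF computable2_diff] recursive_comp1[OF t] recursive.proj
        recursive_comp1[OF computable_Suc[OF computable_id]]) auto
  then have s: "computable (\<lambda>x. LEAST s. Suc x - triangle (Suc s) = 0)"
    using ex by (rule computable_LEAST2)
  show "computable f \<Longrightarrow> computable (\<lambda>x. fst (prod_decode (f x)))"
    by (rule computable_comp[of "\<lambda>x. fst (prod_decode x)"])
      (auto simp only: prod_decode_triangle fst_conv intro!: computable_diff computable_id
        computable_comp[OF t s])
  show "computable f \<Longrightarrow> computable (\<lambda>x. snd (prod_decode (f x)))"
    by (rule computable_comp[of "\<lambda>x. snd (prod_decode x)"])
      (auto simp only: prod_decode_triangle snd_conv intro!: computable_diff computable_id
        computable_comp[OF t s] s)
qed

lemmas computable_prod_encode = computable_comp2[OF computable2_prod_encode]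

text \<open>With pairing available, binary functions reduce to unary ones. Later computability goals
  can therefore be split by the rules of \<open>computable_intros\<close>, which follow the syntax
  of the term, without argument lists.\<close>

lemma computable2I:
  assumes "computable (\<lambda>z. f (fst (prod_decode z)) (snd (prod_decode z)))"
  shows "computable2 f"
proof -
  have "recursive 2 (\<lambda>xs. prod_encode (xs ! 0, xs ! 1))"
    using computable2_prod_encode by (simp add: computable2_def)
  from recursive_comp1[OF assms this] show ?thesis by (simp add: computable2_def)
qed

lemmas computable_intros =
  computable_id computable_const computable_Suc computable_add computable_mult computable_diff
  computable_power computable_prod_encode computable_prod_decode

section \<open>Decidable predicates\<close>

definition decidable :: "(nat \<Rightarrow> bool) \<Rightarrow> bool" where
  "decidable P \<longleftrightarrow> computable (\<lambda>x. of_bool (P x))"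

lemma decidable_comp: "decidable P \<Longrightarrow> computable f \<Longrightarrow> decidable (\<lambda>x. P (f x))"
  unfolding decidable_def by (rule computable_comp)

lemma decidable_const: "decidable (\<lambda>x. b)"
  by (auto simp: decidable_def)

lemma decidable_not: "decidable P \<Longrightarrow> decidable (\<lambda>x. \<not> P x)"
proof -
  assume "decidable P"
  moreover have "of_bool (\<not> P x) = (1 - of_bool (P x) :: nat)" for x by simp
  ultimately show ?thesis
    unfolding decidable_def by (simp only:) (intro computable_intros)
qed

lemma decidable_conj: "decidable P \<Longrightarrow> decidable Q \<Longrightarrow> decidable (\<lambda>x. P x \<and> Q x)"
  unfolding decidable_def of_bool_conj by (intro computable_intros)

lemma decidable_disj: "decidable P \<Longrightarrow> decidable Q \<Longrightarrow> decidable (\<lambda>x. P x \<or> Q x)"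
  using decidable_not[OF decidable_conj[OF decidable_not decidable_not]] by simp

lemma decidable_imp: "decidable P \<Longrightarrow> decidable Q \<Longrightarrow> decidable (\<lambda>x. P x \<longrightarrow> Q x)"
  unfolding imp_conv_disj by (intro decidable_disj decidable_not)

lemma decidable_le:
  assumes "computable f" "computable g"
  shows "decidable (\<lambda>x. f x \<le> g x)"
proof -
  have "of_bool (f x \<le> g x) = 1 - (f x - g x)" for x by simp
  then show ?thesis
    using assms unfolding decidable_def by (simp only:) (intro computable_intros)
qed

lemma decidable_less: "computable f \<Longrightarrow> computable g \<Longrightarrow> decidable (\<lambda>x. f x < g x)"
  unfolding not_le[symmetric] by (intro decidable_not decidable_le)

lemma decidable_eq: "computable f \<Longrightarrow> computable g \<Longrightarrow> decidable (\<lambda>x. f x = g x)"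
  unfolding order_eq_iff by (intro decidable_conj decidable_le)

lemma computable_If:
  assumes "decidable P" "computable f" "computable g"
  shows "computable (\<lambda>x. if P x then f x else g x)"
proof -
  have "(if P x then f x else g x) = of_bool (P x) * f x + (1 - of_bool (P x)) * g x" for x
    by simp
  then show ?thesis
    using assms unfolding decidable_def by (simp only:) (intro computable_intros)
qed

lemma computable_LEAST:
  assumes "decidable (\<lambda>z. P (fst (prod_decode z)) (snd (prod_decode z)))" "\<And>x. \<exists>k. P k x"
  shows "computable (\<lambda>x. LEAST k. P k x)"
proof -
  have "computable2 (\<lambda>k x. of_bool (\<not> P k x))"
    using decidable_not[OF assms(1)] by (intro computable2I) (simp add: decidable_def)
  from computable_LEAST2[OF this] assms(2) show ?thesis by simp
qed

text \<open>Search for the first counterexample, but let the search also stop at the bound.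
  Minimisation is then total, and there is no counterexample below the bound exactly when the search
  gets as far as \<open>b x\<close>.\<close>

lemma decidable_bounded_all:
  assumes P: "decidable (\<lambda>z. P (fst (prod_decode z)) (snd (prod_decode z)))"
    and b: "computable b"
  shows "decidable (\<lambda>x. \<forall>y<b x. P y x)"
proof -
  let ?m = "\<lambda>x. LEAST y. \<not> P y x \<or> b x \<le> y"
  have "computable ?m"
    by (intro computable_LEAST decidable_disj decidable_not P decidable_le
        computable_comp[OF b] computable_intros) (use le_refl in blast)
  moreover have "(\<forall>y<b x. P y x) \<longleftrightarrow> b x \<le> ?m x" for x
  proof
    assume all: "\<forall>y<b x. P y x"
    have "b x \<le> y" if "\<not> P y x \<or> b x \<le> y" for y
      using that all by (meson not_le)
    moreover have "\<not> P (?m x) x \<or> b x \<le> ?m x" by (rule LeastI[of _ "b x"]) simp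
    ultimately show "b x \<le> ?m x" .
  next
    assume le: "b x \<le> ?m x"
    show "\<forall>y<b x. P y x"
    proof (intro allI impI)
      fix y assume "y < b x"
      with le have "y < ?m x" by (rule less_le_trans[rotated])
      from not_less_Least[OF this] show "P y x" by blast
    qed
  qed
  ultimately show ?thesis using b by (simp only: decidable_le)
qed

section \<open>Finite tables and binary digits\<close>

lemma computable_finite_support:
  assumes "finite {x. f x \<noteq> 0}"
  shows "computable f"
  using assms
proof (induction "{x. f x \<noteq> 0}" arbitrary: f rule: finite_induct)
  case empty
  then have "f = (\<lambda>x. 0)" by auto
  then show ?case by auto
next
  case (insert a F)
  let ?g = "f(a := 0)"
  have "F = {x. ?g x \<noteq> 0}" using insert(2,4) by auto
  then have "computable ?g" by (rule insert(3))
  then have "computable (\<lambda>x. if x = a then f a else ?g x)"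
    by (intro computable_If decidable_eq computable_id computable_const)
  moreover have "(\<lambda>x. if x = a then f a else ?g x) = f" by auto
  ultimately show ?case by simp
qed

lemma decidable_finite:
  assumes "finite F" "computable f"
  shows "decidable (\<lambda>x. f x \<in> F)"
proof -
  have "computable (\<lambda>x. of_bool (x \<in> F))"
    by (rule computable_finite_support) (use assms(1) in simp)
  then show ?thesis using assms(2) decidable_comp[of "\<lambda>x. x \<in> F"] by (simp add: decidable_def)
qed

text \<open>Any function on a finite set is computable on codes, however it was obtained, because it
  is a finite table. Inverses and values of letters in the group become available to algorithms in
  this way.\<close>

lemma computable_finite_extension:
  assumes "finite X" "inj_on k X"
  obtains F where "computable F" "\<And>x. x \<in> X \<Longrightarrow> F (k x) = f x"
proof
  let ?F = "\<lambda>n. if n \<in> k ` X then f (the_inv_into X k n) else 0"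
  show "computable ?F"
    by (rule computable_finite_support, rule finite_subset[of _ "k ` X"]) (use assms in auto)
  show "?F (k x) = f x" if "x \<in> X" for x
    using that assms by (simp add: the_inv_into_f_f)
qed

text \<open>Membership in \<open>set_decode n\<close> is a test of a binary digit,
  \<open>odd (n div 2 ^ x)\<close>. The quotient of \<open>a\<close> by \<open>b > 0\<close> is the
  least \<open>q\<close> with \<open>a < b * Suc q\<close>, hence found by minimisation, and parity
  is read off from division by 2.\<close>

lemma decidable_set_decode:
  assumes "computable f" "computable g"
  shows "decidable (\<lambda>x. f x \<in> set_decode (g x))"
proof -
  have div_eq: "(LEAST q. a < b * Suc q) = a div b" if "b > 0" for a b :: nat
  proof (rule Least_equality)
    show "a < b * Suc (a div b)" using that dividend_less_times_div[of b a] by simp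
    show "a div b \<le> q" if "a < b * Suc q" for q
      using that by (metis less_Suc_eq_le mult.commute less_mult_imp_div_less)
  qed
  have ex: "\<exists>q. a < b * Suc q" if "b > 0" for a b :: nat
    using that dividend_less_times_div[of b a] by (intro exI[of _ "a div b"]) simp
  have div: "computable (\<lambda>x. u x div v x)"
    if "computable u" "computable v" "\<And>x. v x > 0" for u v :: "nat \<Rightarrow> nat"
  proof -
    have "computable (\<lambda>x. LEAST q. u x < v x * Suc q)"
      by (intro computable_LEAST decidable_less computable_intros
          computable_comp[OF that(1)] computable_comp[OF that(2)] ex that(3))
    then show ?thesis by (simp only: div_eq[OF that(3)])
  qed
  have odd: "odd n \<longleftrightarrow> n \<noteq> 2 * (n div 2)" for n :: nat by presburger
  have "computable (\<lambda>x. g x div 2 ^ f x)"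
    by (intro div computable_intros assms) simp
  then have "decidable (\<lambda>x. odd (g x div 2 ^ f x))"
    unfolding odd by (intro decidable_not decidable_eq computable_intros div assms) auto
  then show ?thesis by (simp add: set_decode_def)
qed

lemmas decidable_intros =
  decidable_const decidable_not decidable_conj decidable_disj decidable_imp decidable_le
  decidable_less decidable_eq decidable_set_decode

section \<open>Recursively enumerable sets as projections\<close>

text \<open>The enumeration runs through all coded pairs of a witness and a candidate. Since it must
  be total, a pair that fails the test is sent to a fixed element \<open>e\<close> of the set; the
  empty set has no such element and is covered by its own clause in the definition.\<close>

lemma recursively_enumerable_projection:
  assumes "decidable (\<lambda>z. R (fst (prod_decode z)) (snd (prod_decode z)))"
  shows "recursively_enumerable {n. \<exists>k. R k n}"
proof (cases "{n. \<exists>k. R k n} = {}")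
  case False
  then obtain e where e: "\<exists>k. R k e" by blast
  let ?f = "\<lambda>z. if R (fst (prod_decode z)) (snd (prod_decode z)) then snd (prod_decode z) else e"
  have "{n. \<exists>k. R k n} = range ?f"
  proof (rule Set.set_eqI, rule iffI)
    fix n assume "n \<in> {n. \<exists>k. R k n}"
    then obtain k where "R k n" by blast
    then show "n \<in> range ?f" by (intro image_eqI[of _ _ "prod_encode (k, n)"]) auto
  qed (use e in auto)
  moreover have "computable ?f" by (intro computable_If computable_intros assms)
  ultimately show ?thesis
    unfolding recursively_enumerable_def computable_def
    by (intro disjI2 exI[of _ "\<lambda>xs. ?f (hd xs)"]) (simp del: split_paired_Ex)
qed (simp add: recursively_enumerable_def)

lemma recursively_enumerableE:
  assumes "recursively_enumerable E"
  obtains R where "decidable (\<lambda>z. R (fst (prod_decode z)) (snd (prod_decode z)))"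
    and "\<And>n. n \<in> E \<longleftrightarrow> (\<exists>k. R k n)"
proof (cases "E = {}")
  case True
  show ?thesis by (rule that[of "\<lambda>_ _. False"]) (auto simp: True intro: decidable_const)
next
  case False
  then obtain f where f: "recursive 1 f" and E: "E = range (\<lambda>k. f [k])"
    using assms by (auto simp: recursively_enumerable_def)
  have "computable (\<lambda>k. f [k])"
    unfolding computable_def by (rule recursive.cong[OF f]) (auto simp: length_Suc_conv)
  note c = computable_comp[OF this]
  show ?thesis
    by (rule that[of "\<lambda>k n. n = f [k]"]) (auto simp: E intro!: decidable_intros computable_intros c)
qed

section \<open>Computations on coded lists\<close>

lemma computable_foldl:
  assumes g: "computable2 g" and a: "computable a" and l: "computable l"
  shows "computable (\<lambda>x. foldl g (a x) (list_decode (l x)))"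
proof -
  \<comment> \<open>A state pairs the accumulator with the rest of the list; as a list is no longer than its code,
    \<open>l x\<close> steps suffice.\<close>
  define step where "step s = (if snd (prod_decode s) = 0 then s
    else prod_encode (g (fst (prod_decode s)) (fst (prod_decode (snd (prod_decode s) - 1))),
      snd (prod_decode (snd (prod_decode s) - 1))))" for s
  have "computable step"
    unfolding step_def
    by (intro computable_If decidable_intros computable_intros computable_comp2[OF g])
  then have *: "computable (\<lambda>x. fst (prod_decode ((step ^^ l x) (prod_encode (a x, l x)))))"
    by (intro computable_prod_decode computable_comp2[OF computable2_funpow] computable_intros a l)
  have run: "(step ^^ n) (prod_encode (b, list_encode ys)) = prod_encode (foldl g b ys, 0)"
    if "length ys \<le> n" for n b ys
    using that
  proof (induction n arbitrary: b ys)
    case (Suc n)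
    show ?case
    proof (cases ys)
      case Nil
      then show ?thesis using Suc.IH[of "[]" b] by (simp add: step_def)
    next
      case (Cons y ys')
      then show ?thesis
        using Suc by (simp add: step_def funpow_Suc_right del: funpow.simps)
    qed
  qed simp
  have len: "length (list_decode n) \<le> n" for n
  proof (induction n rule: less_induct)
    case (less n)
    show ?case
    proof (cases n)
      case (Suc m)
      have "snd (prod_decode m) \<le> m"
        by (metis le_prod_encode_2 prod.collapse prod_decode_inverse)
      then show ?thesis
        using less[of "snd (prod_decode m)"] Suc by (auto split: prod.splits)
    qed simp
  qed
  have "(step ^^ l x) (prod_encode (a x, l x)) = prod_encode (foldl g (a x) (list_decode (l x)), 0)"
    for x
    using run[OF len[of "l x"], of "a x"] by simp
  with * show ?thesis by simp
qed

text \<open>\<open>foldr\<close> is a \<open>foldl\<close> over the reversed list, and reversal of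
  codes is itself a \<open>foldl\<close>: it starts from 0, the code of the empty list, and pushes
  each entry onto the front.\<close>

lemma computable_foldr:
  assumes g: "computable2 g" and a: "computable a" and l: "computable l"
  shows "computable (\<lambda>x. foldr g (list_decode (l x)) (a x))"
proof -
  have "foldl (\<lambda>acc x. Suc (prod_encode (x, acc))) (list_encode zs) ys
      = list_encode (rev ys @ zs)" for ys zs
    by (induction ys arbitrary: zs) (simp_all flip: list_encode.simps)
  from this[of "[]"] have "foldl (\<lambda>acc x. Suc (prod_encode (x, acc))) 0 ys = list_encode (rev ys)" for ys
    by simp
  moreover have "computable (\<lambda>x. foldl (\<lambda>acc x. Suc (prod_encode (x, acc))) 0 (list_decode (l x)))"
    by (intro computable_foldl computable2I computable_intros l)
  ultimately have "computable (\<lambda>x. list_encode (rev (list_decode (l x))))"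
    by simp
  from computable_foldl[OF computable2_flip[OF g] a this]
  show ?thesis by (simp add: foldr_conv_foldl)
qed

lemma decidable_list_all:
  assumes "decidable P" and l: "computable l"
  shows "decidable (\<lambda>x. list_all P (list_decode (l x)))"
proof -
  have "foldr (\<lambda>x b. of_bool (P x) * b) ys 1 = (of_bool (list_all P ys) :: nat)" for ys
    by (induction ys) auto
  moreover have c: "computable (\<lambda>x. of_bool (P (f x)))" if "computable f" for f
    using decidable_comp[OF assms(1) that] by (simp add: decidable_def)
  moreover have "computable (\<lambda>x. foldr (\<lambda>x b. of_bool (P x) * b) (list_decode (l x)) 1)"
    by (intro computable_foldr computable2I computable_intros c l)
  ultimately show ?thesis by (simp add: decidable_def)
qed

text \<open>\<open>list_encode\<close> is a bijection onto the natural numbers, so every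
  \<open>n\<close> codes some list and only the entries of that list have to be tested.\<close>

lemma coded_lists_iff:
  "n \<in> (\<lambda>w. list_encode (map k w)) ` lists X \<longleftrightarrow> list_all (\<lambda>x. x \<in> k ` X) (list_decode n)"
proof -
  have "n \<in> (\<lambda>w. list_encode (map k w)) ` lists X \<longleftrightarrow> list_decode n \<in> map k ` lists X"
  proof -
    have "n = list_encode ys \<longleftrightarrow> list_decode n = ys" for ys by auto
    then show ?thesis by (auto simp: image_iff)
  qed
  then show ?thesis by (simp add: lists_image[symmetric] list_all_iff subset_eq in_lists_conv_set)
qed

lemma decidable_coded_lists:
  assumes "finite X" "computable f"
  shows "decidable (\<lambda>x. f x \<in> (\<lambda>w. list_encode (map k w)) ` lists X)"
  unfolding coded_lists_iff using assms
  by (intro decidable_list_all decidable_finite computable_id) auto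

lemma computable_map:
  assumes "computable F" "computable l"
  shows "computable (\<lambda>x. list_encode (map F (list_decode (l x))))"
proof -
  have "foldr (\<lambda>y acc. Suc (prod_encode (F y, acc))) ys 0 = list_encode (map F ys)" for ys
    by (induction ys) auto
  moreover have "computable (\<lambda>x. foldr (\<lambda>y acc. Suc (prod_encode (F y, acc))) (list_decode (l x)) 0)"
    by (intro computable_foldr computable2I computable_intros computable_comp[OF assms(1)] assms(2))
  ultimately show ?thesis by simp
qed

lemma map_in_lists: "w \<in> lists A \<Longrightarrow> (\<And>x. x \<in> A \<Longrightarrow> f x \<in> B) \<Longrightarrow> map f w \<in> lists B"
  by auto

section \<open>Codes of words and patterns\<close>

definition word_code :: "('x \<Rightarrow> nat) \<Rightarrow> 'x list \<Rightarrow> nat" where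
  "word_code k w = list_encode (map k w)"

lemma word_code_simps [simp]:
  "word_code k [] = 0"
  "word_code k (x # w) = Suc (prod_encode (k x, word_code k w))"
  by (simp_all add: word_code_def)

lemma inj_on_word_code: "inj_on k X \<Longrightarrow> inj_on (word_code k) (lists X)"
proof (rule inj_onI)
  fix v w assume "inj_on k X" "v \<in> lists X" "w \<in> lists X" "word_code k v = word_code k w"
  then show "v = w"
    by (auto simp: word_code_def list_encode_eq intro: map_inj_on inj_on_subset)
qed

lemma inj_on_letter_code: "inj_on c S \<Longrightarrow> inj_on (letter_code c) (S \<times> UNIV)"
  by (auto simp: inj_on_def letter_code_def of_bool_eq_iff)

lemma computable_reduction:
  assumes S: "finite S" "inj_on c S"
  obtains red where "computable red"
    "\<And>w. w \<in> lists (S \<times> UNIV) \<Longrightarrow>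
      red (word_code (letter_code c) w) = word_code (letter_code c) (foldr reduced_cons w [])"
proof -
  let ?k = "letter_code c"
  have inj: "inj_on ?k (S \<times> UNIV)" by (rule inj_on_letter_code[OF S(2)])
  have "finite (S \<times> (UNIV :: bool set))" using S(1) by simp
  from computable_finite_extension[OF this inj, of "\<lambda>x. ?k (inv_letter x)"]
  obtain iv where iv: "computable iv"
    "\<And>x. x \<in> S \<times> UNIV \<Longrightarrow> iv (?k x) = ?k (inv_letter x)" by metis
  \<comment> \<open>This is \<open>reduced_cons\<close> on codes. The empty word has code 0, and a
    nonempty one is \<open>Suc\<close> of the pair of head and tail, so \<open>n - 1\<close> exposes
    the head that may cancel.\<close>
  define step where "step x n = (if n \<noteq> 0 \<and> fst (prod_decode (n - 1)) = iv x
    then snd (prod_decode (n - 1)) else Suc (prod_encode (x, n)))" for x n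
  have "computable2 step"
    unfolding step_def
    by (intro computable2I computable_If decidable_intros computable_intros computable_comp[OF iv(1)])
  then have "computable (\<lambda>n. foldr step (list_decode n) 0)"
    by (intro computable_foldr computable_intros)
  moreover have "foldr step (map ?k w) 0 = word_code ?k (foldr reduced_cons w [])"
    if "w \<in> lists (S \<times> UNIV)" for w
    using that
  proof (induction w)
    case (Cons x w)
    let ?v = "foldr reduced_cons w []"
    note x = Cons.hyps(1) and w = Cons.hyps(2)
    have v: "?v \<in> lists (S \<times> UNIV)"
      by (rule foldr_reduced_cons_lists[OF w]) simp
    have ix: "inv_letter x \<in> S \<times> UNIV" using x by (cases x) auto
    have "step (?k x) (word_code ?k ?v) = word_code ?k (reduced_cons x ?v)"
    proof (cases ?v)
      case (Cons y u)
      then have "y \<in> S \<times> UNIV" using v by auto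
      then have "?k y = ?k (inv_letter x) \<longleftrightarrow> y = inv_letter x"
        using inj_on_eq_iff[OF inj _ ix] by blast
      then show ?thesis using Cons x by (simp add: step_def iv(2))
    qed (simp add: step_def)
    with Cons.IH show ?case by simp
  qed simp
  ultimately show ?thesis
    by (intro that[of "\<lambda>n. foldr step (list_decode n) 0"]) (simp_all add: word_code_def)
qed

text \<open>Reduced words are the fixed points of free reduction, so reducedness becomes an equation
  between codes.\<close>

lemma decidable_free_group_codes:
  assumes "finite S" "inj_on c S" "computable f"
  shows "decidable (\<lambda>x. f x \<in> word_code (letter_code c) ` carrier (free_group S))"
proof -
  let ?k = "letter_code c"
  obtain red where red: "computable red"
    "\<And>w. w \<in> lists (S \<times> UNIV) \<Longrightarrow>
      red (word_code ?k w) = word_code ?k (foldr reduced_cons w [])"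
    using computable_reduction[OF assms(1,2)] by metis
  have "n \<in> word_code ?k ` carrier (free_group S) \<longleftrightarrow>
      n \<in> word_code ?k ` lists (S \<times> UNIV) \<and> red n = n" for n
  proof
    assume "n \<in> word_code ?k ` carrier (free_group S)"
    then obtain w where "w \<in> lists (S \<times> UNIV)" "reduced w" "n = word_code ?k w"
      by (auto simp: free_group_def)
    moreover from this have "red n = n" by (simp only: red(2) foldr_reduced_cons_Nil)
    ultimately show "n \<in> word_code ?k ` lists (S \<times> UNIV) \<and> red n = n" by blast
  next
    assume n: "n \<in> word_code ?k ` lists (S \<times> UNIV) \<and> red n = n"
    then obtain w where w: "w \<in> lists (S \<times> UNIV)" "n = word_code ?k w" by blast
    with n have "word_code ?k (foldr reduced_cons w []) = word_code ?k w" by (simp add: red(2))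
    moreover have "foldr reduced_cons w [] \<in> lists (S \<times> UNIV)"
      by (rule foldr_reduced_cons_lists[OF w(1)]) simp
    ultimately have "foldr reduced_cons w [] = w"
      using inj_on_word_code[OF inj_on_letter_code[OF assms(2)]] w(1) by (blast dest: inj_onD)
    then have "reduced w" using reduced_foldr[of "[]" w] by simp
    then show "n \<in> word_code ?k ` carrier (free_group S)"
      using w by (auto simp: free_group_def)
  qed
  moreover have "decidable (\<lambda>x. f x \<in> word_code ?k ` lists (S \<times> UNIV))"
    using decidable_coded_lists[of "S \<times> UNIV" f ?k] assms by (simp add: word_code_def)
  ultimately show ?thesis
    using assms(3) red(1) by (simp only:) (intro decidable_intros computable_comp[OF red(1)])
qed

section \<open>Patterns coded as finite graphs\<close>

lemma mem_set_decode_pattern_code: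
  assumes "p \<in> patterns S A"
  shows "z \<in> set_decode (pattern_code c d p) \<longleftrightarrow>
    (\<exists>w a. p w = Some a \<and> z = prod_encode (word_code (letter_code c) w, d a))"
proof -
  have "Map.graph p = (\<lambda>w. (w, the (p w))) ` dom p"
    by (auto simp: Map.graph_def image_iff)
  \<comment> \<open>\<open>set_decode\<close> inverts \<open>set_encode\<close> on finite sets
    only.\<close>
  then have "finite (Map.graph p)" using assms by (simp add: patterns_def)
  then show ?thesis
    by (auto simp: pattern_code_def set_encode_inverse word_code_def image_iff Map.graph_def)
qed

lemma inj_on_pattern_code:
  assumes "inj_on c S" "inj_on d A"
  shows "inj_on (pattern_code c d) (patterns S A)"
proof (rule inj_onI)
  \<comment> \<open>This is one inclusion between the graphs; exchanging \<open>p\<close> and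
    \<open>q\<close> gives the other.\<close>
  have *: "p w = Some a" if pq: "p \<in> patterns S A" "q \<in> patterns S A"
    "pattern_code c d p = pattern_code c d q" and q: "q w = Some a" for p q w a
  proof -
    have "prod_encode (word_code (letter_code c) w, d a) \<in> set_decode (pattern_code c d p)"
      using pq q by (auto simp: mem_set_decode_pattern_code)
    then obtain v b where vb: "p v = Some b" "d a = d b"
      "word_code (letter_code c) w = word_code (letter_code c) v"
      using pq(1) by (auto simp: mem_set_decode_pattern_code)
    have "v \<in> lists (S \<times> UNIV)" "w \<in> lists (S \<times> UNIV)" "a \<in> A" "b \<in> A"
      using pq(1,2) q vb(1) by (auto simp: patterns_def free_group_def ran_def dom_def)
    then have "w = v" "a = b"
      using vb inj_on_word_code[OF inj_on_letter_code[OF assms(1)]] assms(2)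
      by (auto dest: inj_onD simp del: in_lists_conv_set)
    then show ?thesis using vb by simp
  qed
  fix p q assume pq: "p \<in> patterns S A" "q \<in> patterns S A" "pattern_code c d p = pattern_code c d q"
  show "p = q"
  proof
    fix w
    have "p w = Some a \<longleftrightarrow> q w = Some a" for a
      using *[OF pq] *[OF pq(2,1) pq(3)[symmetric]] by blast
    then show "p w = q w" by (metis option.exhaust)
  qed
qed

text \<open>Elements of \<open>set_decode n\<close> are below \<open>n\<close>; the redundant bounds make the condition decidable.\<close>

lemma pattern_codes_iff:
  assumes "inj_on c S" "inj_on d A"
  shows "n \<in> pattern_code c d ` patterns S A \<longleftrightarrow>
    (\<forall>z<n. z \<in> set_decode n \<longrightarrow>
      fst (prod_decode z) \<in> word_code (letter_code c) ` carrier (free_group S) \<and>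
      snd (prod_decode z) \<in> d ` A \<and>
      (\<forall>z'<n. z' \<in> set_decode n \<longrightarrow> fst (prod_decode z') = fst (prod_decode z) \<longrightarrow> z' = z))"
  (is "_ \<longleftrightarrow> ?valid")
proof
  let ?k = "letter_code c"
  have inj: "inj_on (word_code ?k) (carrier (free_group S))"
    by (rule inj_on_subset[OF inj_on_word_code[OF inj_on_letter_code[OF assms(1)]]])
      (auto simp: free_group_def)
  {
    assume "n \<in> pattern_code c d ` patterns S A"
    then obtain p where p: "p \<in> patterns S A" "n = pattern_code c d p" by blast
    have dom: "w \<in> carrier (free_group S) \<and> a \<in> A" if "p w = Some a" for w a
      using p(1) that by (auto simp: patterns_def ran_def dom_def)
    have same: "a = b" if "p v = Some a" "p w = Some b" "word_code ?k v = word_code ?k w" for v w a b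
      using inj_onD[OF inj that(3)] dom that(1,2) by auto
    show ?valid
      using dom by (auto simp: p(2) mem_set_decode_pattern_code[OF p(1)] intro!: arg_cong[of _ _ d]
          elim!: same)
  }
  assume valid: ?valid
  have less: "z < n" if "z \<in> set_decode n" for z
  proof -
    have "n div 2 ^ z \<noteq> 0" using that by (auto simp: set_decode_def intro: ccontr)
    then have "2 ^ z \<le> n" by (metis div_less not_le)
    then show ?thesis using less_exp[of z] by linarith
  qed
  let ?e = "\<lambda>w a. prod_encode (word_code ?k w, d a)"
  have uniq: "a = b" if "?e w a \<in> set_decode n" "?e w b \<in> set_decode n" "a \<in> A" "b \<in> A" for w a b
  proof -
    have "?e w a = ?e w b" using valid less that(1,2) by (metis fst_conv prod_encode_inverse)
    then show ?thesis using that(3,4) assms(2) by (auto dest: inj_onD)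
  qed
  \<comment> \<open>The pattern is read off from the binary digits of \<open>n\<close>. By
    \<open>uniq\<close> at most one letter qualifies at each word, so the choice by
    \<open>SOME\<close> is forced.\<close>
  define p where "p w = (if \<exists>a\<in>A. w \<in> carrier (free_group S) \<and> ?e w a \<in> set_decode n
    then Some (SOME a. a \<in> A \<and> ?e w a \<in> set_decode n) else None)" for w
  have p: "p w = Some a \<longleftrightarrow> a \<in> A \<and> w \<in> carrier (free_group S) \<and> ?e w a \<in> set_decode n" for w a
  proof
    assume pw: "p w = Some a"
    then have w: "\<exists>a. a \<in> A \<and> ?e w a \<in> set_decode n" "w \<in> carrier (free_group S)"
      "a = (SOME a. a \<in> A \<and> ?e w a \<in> set_decode n)"
      by (auto simp: p_def split: if_splits)
    show "a \<in> A \<and> w \<in> carrier (free_group S) \<and> ?e w a \<in> set_decode n"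
      using someI_ex[OF w(1)] w(2,3) by simp
  next
    assume a: "a \<in> A \<and> w \<in> carrier (free_group S) \<and> ?e w a \<in> set_decode n"
    then have "(SOME a. a \<in> A \<and> ?e w a \<in> set_decode n) = a"
      using uniq by (intro some_equality) auto
    then show "p w = Some a" using a by (auto simp: p_def)
  qed
  have "dom p \<subseteq> carrier (free_group S)" by (auto simp: p dom_def)
  moreover have "finite (dom p)"
  proof (rule inj_on_finite)
    show "inj_on (word_code ?k) (dom p)" by (rule inj_on_subset[OF inj]) fact
    show "word_code ?k ` dom p \<subseteq> (\<lambda>z. fst (prod_decode z)) ` set_decode n"
    proof (rule image_subsetI)
      fix w assume "w \<in> dom p"
      then obtain a where "?e w a \<in> set_decode n" by (auto simp: p dom_def)
      then show "word_code ?k w \<in> (\<lambda>z. fst (prod_decode z)) ` set_decode n"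
        by (rule rev_image_eqI) simp
    qed
  qed simp
  moreover have "ran p \<subseteq> A" by (auto simp: p ran_def)
  ultimately have pat: "p \<in> patterns S A" by (simp add: patterns_def)
  have "set_decode (pattern_code c d p) = set_decode n"
  proof (rule Set.set_eqI, rule iffI)
    fix z assume "z \<in> set_decode (pattern_code c d p)"
    then show "z \<in> set_decode n" by (auto simp: mem_set_decode_pattern_code[OF pat] p)
  next
    fix z assume z: "z \<in> set_decode n"
    with valid less[OF z] obtain w a where "w \<in> carrier (free_group S)" "a \<in> A"
      "fst (prod_decode z) = word_code ?k w" "snd (prod_decode z) = d a" by blast
    moreover from this have "z = ?e w a" by (metis prod.collapse prod_decode_inverse)
    ultimately show "z \<in> set_decode (pattern_code c d p)"
      using z by (auto simp: mem_set_decode_pattern_code[OF pat] p)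
  qed
  then have "n = pattern_code c d p" by (metis set_decode_inverse)
  with pat show "n \<in> pattern_code c d ` patterns S A" by blast
qed

text \<open>Two conflicting entries show that a pattern is forbidden only once \<open>n\<close> is
  known to code a pattern; this test keeps all other numbers out of the enumeration.\<close>

lemma decidable_pattern_codes:
  assumes "finite S" "inj_on c S" "finite A" "inj_on d A"
  shows "decidable (\<lambda>n. n \<in> pattern_code c d ` patterns S A)"
  unfolding pattern_codes_iff[OF assms(2,4)]
  by (intro decidable_bounded_all decidable_intros computable_intros
      decidable_free_group_codes assms decidable_finite finite_imageI)

section \<open>The full shift\<close>

context group
begin

text \<open>Without a conflict the pattern is constant on the fibres of
  \<open>canonical_epi G\<close>, so it descends to a partial function on the group. The full shift
  imposes no constraint, hence any extension of that function to the whole group is a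
  configuration.\<close>

lemma mem_forbidden_patterns_full_shift:
  assumes S: "S \<subseteq> carrier G" and A: "A \<noteq> {}"
  shows "p \<in> forbidden_patterns S A (pullback G S (full_shift G A)) \<longleftrightarrow>
    p \<in> patterns S A \<and> (\<exists>u v a b. p u = Some a \<and> p v = Some b \<and> a \<noteq> b \<and>
      canonical_epi G u = canonical_epi G v)" (is "_ \<longleftrightarrow> _ \<and> ?conflict")
proof (cases "p \<in> patterns S A")
  case p: True
  then have dom: "w \<in> carrier (free_group S) \<and> a \<in> A" if "p w = Some a" for w a
    using that by (auto simp: patterns_def ran_def dom_def)
  have mem: "canonical_epi G w \<in> carrier G" if "w \<in> carrier (free_group S)" for w
    using canonical_epi_hom[OF S] that by (auto simp: hom_def)
  have "(\<exists>y\<in>pullback G S (full_shift G A). \<forall>w\<in>dom p. p w = Some (y w)) \<longleftrightarrow> \<not> ?conflict"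
  proof
    assume "\<exists>y\<in>pullback G S (full_shift G A). \<forall>w\<in>dom p. p w = Some (y w)"
    then obtain x where x: "\<And>w. w \<in> dom p \<Longrightarrow>
        p w = Some (compose (carrier (free_group S)) x (canonical_epi G) w)"
      by (auto simp: pullback_def)
    have "a = x (canonical_epi G w)" if "p w = Some a" for w a
      using x[of w] dom[OF that] that by (auto simp: compose_def dom_def)
    then show "\<not> ?conflict" by metis
  next
    assume nc: "\<not> ?conflict"
    obtain a0 where a0: "a0 \<in> A" using A by blast
    \<comment> \<open>\<open>P\<close> is the graph of the partial function induced on the group;
      where it is undefined, \<open>x\<close> takes the default letter \<open>a0\<close>.\<close>
    define P where "P g a \<longleftrightarrow> (\<exists>w. p w = Some a \<and> canonical_epi G w = g)" for g a
    define x where "x = (\<lambda>g\<in>carrier G. if \<exists>a. P g a then SOME a. P g a else a0)"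
    have "x g \<in> A" if "g \<in> carrier G" for g
    proof (cases "\<exists>a. P g a")
      case True
      from someI_ex[OF this] have "(SOME a. P g a) \<in> A" using dom by (auto simp: P_def)
      then show ?thesis using that True by (simp add: x_def)
    qed (use a0 that in \<open>auto simp: x_def\<close>)
    then have "x \<in> full_shift G A" by (auto simp: full_shift_def x_def)
    moreover have "x (canonical_epi G w) = a" if w: "p w = Some a" for w a
    proof -
      have P: "P (canonical_epi G w) a" using w by (auto simp: P_def)
      have "(SOME b. P (canonical_epi G w) b) = a"
      proof (rule some_equality[of "P (canonical_epi G w)", OF P])
        fix b assume "P (canonical_epi G w) b"
        then show "b = a" using nc w by (auto simp: P_def)
      qed
      then show ?thesis using P mem dom[OF w] by (auto simp: x_def)
    qed
    then have "p w = Some (compose (carrier (free_group S)) x (canonical_epi G) w)"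
      if "w \<in> dom p" for w
      using that dom by (auto simp: compose_def)
    ultimately show "\<exists>y\<in>pullback G S (full_shift G A). \<forall>w\<in>dom p. p w = Some (y w)"
      by (auto simp: pullback_def)
  qed
  then show ?thesis
    using p by (simp only: forbidden_patterns_def mem_Collect_eq not_not simp_thms)
qed (auto simp: forbidden_patterns_def)

section \<open>Equality under the canonical epimorphism as a word problem\<close>

lemma canonical_epi_reduce:
  assumes "S \<subseteq> carrier G" "w \<in> lists (S \<times> UNIV)"
  shows "canonical_epi G (foldr reduced_cons w []) = canonical_epi G w"
  using assms(2)
proof (induction w)
  case (Cons x w)
  then have "foldr reduced_cons w [] \<in> lists (S \<times> UNIV)"
    by (intro foldr_reduced_cons_lists) auto
  with Cons show ?case
    by (simp add: canonical_epi_reduced_cons[OF assms(1)] canonical_epi_Cons)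
qed simp

text \<open>The tail \<open>z\<close> carries the induction on \<open>u\<close>: the first letter of
  \<open>u\<close> is inverted at the end of the reversed word, hence next to \<open>z\<close>, and
  is absorbed into it.\<close>

lemma word_value_inverse_append:
  assumes "S \<subseteq> carrier G" "u \<in> lists (S \<times> UNIV)" "z \<in> lists (carrier G)"
  shows "word_value G (map (\<lambda>x. letter_value G (inv_letter x)) (rev u) @ z) =
    inv (canonical_epi G u) \<otimes> word_value G z"
  using assms(2,3)
proof (induction u arbitrary: z)
  case Nil
  have "word_value G z \<in> carrier G"
    using Nil by (induction z) (auto simp: word_value_def)
  then show ?case by (simp add: canonical_epi_Nil)
next
  case (Cons x u)
  let ?y = "letter_value G (inv_letter x)"
  note x = Cons.hyps(1) and u = Cons.hyps(2)
  have mem: "letter_value G x \<in> carrier G" "canonical_epi G u \<in> carrier G"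
    using letter_value_closed[OF assms(1) x] canonical_epi_closed[OF assms(1) u] .
  have y: "?y = inv (letter_value G x)"
    using x assms(1) by (cases x) (auto simp: letter_value_def)
  have z: "word_value G z \<in> carrier G"
    using Cons.prems by (induction z) (auto simp: word_value_def)
  have "?y # z \<in> lists (carrier G)" using y mem Cons.prems by auto
  from Cons.IH[OF this] show ?case
    using mem z by (simp add: y canonical_epi_Cons word_value_def inv_mult_group m_assoc)
qed

lemma inverse_append_in_lists:
  assumes "symmetric_set G S" "u \<in> lists (S \<times> UNIV)" "v \<in> lists (S \<times> UNIV)"
  shows "map (\<lambda>x. letter_value G (inv_letter x)) (rev u) @ map (letter_value G) v \<in> lists S"
proof -
  have lv: "letter_value G x \<in> S" if "x \<in> S \<times> UNIV" for x
    using that assms(1) by (auto simp: letter_value_def symmetric_set_def)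
  have iv: "inv_letter x \<in> S \<times> UNIV" if "x \<in> S \<times> UNIV" for x
    using that by (cases x) auto
  have "rev u \<in> lists (S \<times> UNIV)" using assms(2) by (simp only: in_lists_conv_set set_rev)
  then have "map (\<lambda>x. letter_value G (inv_letter x)) (rev u) \<in> lists S"
    by (rule map_in_lists) (intro lv iv)
  moreover have "map (letter_value G) v \<in> lists S"
    using assms(3) by (rule map_in_lists) (rule lv)
  ultimately show ?thesis by simp
qed

text \<open>The displayed word spells u^-1 v without cancellation. Symmetry of \<open>S\<close>
  ensures that the values of inverse letters are again letters of the word problem.\<close>

lemma canonical_epi_eq_iff_word_problem:
  assumes S: "S \<subseteq> carrier G" "symmetric_set G S"
    and uv: "u \<in> lists (S \<times> UNIV)" "v \<in> lists (S \<times> UNIV)"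
  shows "canonical_epi G u = canonical_epi G v \<longleftrightarrow>
    map (\<lambda>x. letter_value G (inv_letter x)) (rev u) @ map (letter_value G) v \<in> word_problem G S"
proof -
  have mem: "canonical_epi G u \<in> carrier G" "canonical_epi G v \<in> carrier G"
    using canonical_epi_closed[OF S(1)] uv by auto
  note w = inverse_append_in_lists[OF S(2) uv]
  then have "map (letter_value G) v \<in> lists (carrier G)"
    using S(1) by auto
  from word_value_inverse_append[OF S(1) uv(1) this]
  have "word_value G (map (\<lambda>x. letter_value G (inv_letter x)) (rev u) @ map (letter_value G) v) =
      inv (canonical_epi G u) \<otimes> canonical_epi G v"
    by (simp add: canonical_epi_def)
  then show ?thesis
    using mem w by (auto simp: word_problem_def inv_solve_left' l_inv
        simp del: in_lists_conv_set dest: inv_equality)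
qed

section \<open>From a recursive presentation to effectiveness\<close>

lemma effective_full_shift_if_recursively_presented:
  assumes A: "finite A" "A \<noteq> {}" and G: "recursively_presented G"
  shows "effective_subshift G A (full_shift G A)"
proof -
  obtain S c where S: "finite S" "generating_set G S" "symmetric_set G S" and c: "numbering S c"
    and re: "recursively_enumerable (word_code c ` word_problem G S)"
    using G by (auto simp: recursively_presented_def re_language_def word_code_def)
  obtain d where d: "numbering A d"
    using ex_bij_betw_finite_nat[OF A(1)] by (auto simp: numbering_def atLeast0LessThan)
  have inj: "inj_on c S" "inj_on d A" using c d by (auto simp: numbering_def bij_betw_def)
  have SG: "S \<subseteq> carrier G" using S(2) by (simp add: generating_set_def)
  let ?k = "letter_code c"
  let ?V = "letter_value G" and ?I = "\<lambda>x. letter_value G (inv_letter x)"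
  have injk: "inj_on ?k (S \<times> UNIV)" by (rule inj_on_letter_code[OF inj(1)])
  have fin: "finite (S \<times> (UNIV :: bool set))" using S(1) by simp
  \<comment> \<open>\<open>V\<close> and \<open>I\<close> translate the code of a formal letter into
    the number of the generator that it, respectively its inverse, represents.\<close>
  obtain V where V: "computable V" "\<And>x. x \<in> S \<times> UNIV \<Longrightarrow> V (?k x) = c (?V x)"
    using computable_finite_extension[OF fin injk, of "\<lambda>x. c (?V x)"] by metis
  obtain I where I: "computable I" "\<And>x. x \<in> S \<times> UNIV \<Longrightarrow> I (?k x) = c (?I x)"
    using computable_finite_extension[OF fin injk, of "\<lambda>x. c (?I x)"] by metis
  \<comment> \<open>\<open>D\<close> computes the code of the word for u^-1 v. Reading
    \<open>u\<close> from the left while pushing inverses onto the front of \<open>v\<close>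
    performs the reversal along the way.\<close>
  define D where "D m n =
    foldl (\<lambda>acc x. Suc (prod_encode (I x, acc))) (list_encode (map V (list_decode n))) (list_decode m)"
    for m n
  have D: "D (word_code ?k u) (word_code ?k v) = word_code c (map ?I (rev u) @ map ?V v)"
    if "u \<in> lists (S \<times> UNIV)" "v \<in> lists (S \<times> UNIV)" for u v
  proof -
    have v: "map V (map ?k v) = map c (map ?V v)" using that(2) V(2) by auto
    have u: "foldl (\<lambda>acc x. Suc (prod_encode (I x, acc))) (word_code c z) (map ?k u) =
        word_code c (map ?I (rev u) @ z)" for z
      using that(1)
    proof (induction u arbitrary: z)
      case (Cons x u)
      then show ?case using Cons.IH[of "?I x # z"] I(2)[of x] by simp
    qed simp
    show ?thesis
      by (simp only: D_def word_code_def[of ?k] list_encode_inverse v)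
        (simp only: u flip: word_code_def)
  qed
  have compD: "computable (\<lambda>x. D (f x) (g x))" if "computable f" "computable g" for f g
    unfolding D_def
    by (intro computable_foldl computable2I computable_map computable_intros V(1) that
        computable_comp[OF I(1)])
  obtain R where R: "decidable (\<lambda>z. R (fst (prod_decode z)) (snd (prod_decode z)))"
    "\<And>n. n \<in> word_code c ` word_problem G S \<longleftrightarrow> (\<exists>k. R k n)"
    by (rule recursively_enumerableE[OF re], rule that)
  have decR: "decidable (\<lambda>x. R (f x) (g x))" if "computable f" "computable g" for f g
    using decidable_comp[OF R(1) computable_prod_encode[OF that]] by simp
  let ?E = "pattern_code c d ` forbidden_patterns S A (pullback G S (full_shift G A))"
  \<comment> \<open>The witnesses are two entries \<open>z\<close>, \<open>z'\<close> of the pattern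
    with different letters, and a stage \<open>j\<close> at which u^-1 v is confirmed to lie in the
    word problem. Letters are compared through their numbers, which is faithful because
    \<open>d\<close> is injective on \<open>A\<close>.\<close>
  define Q where "Q z z' j n \<longleftrightarrow> n \<in> pattern_code c d ` patterns S A \<and>
    z \<in> set_decode n \<and> z' \<in> set_decode n \<and> snd (prod_decode z) \<noteq> snd (prod_decode z') \<and>
    R j (D (fst (prod_decode z)) (fst (prod_decode z')))" for z z' j n
  have "n \<in> ?E \<longleftrightarrow> (\<exists>z z' j. Q z z' j n)" for n
  proof (cases "n \<in> pattern_code c d ` patterns S A")
    case True
    then obtain p where p: "p \<in> patterns S A" "n = pattern_code c d p" by blast
    have dom: "w \<in> lists (S \<times> UNIV)" "a \<in> A" if "p w = Some a" for w a
      using p(1) that by (auto simp: patterns_def ran_def dom_def free_group_def)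
    have wp: "(\<exists>j. R j (D (word_code ?k u) (word_code ?k v))) \<longleftrightarrow>
        canonical_epi G u = canonical_epi G v" if "p u = Some a" "p v = Some b" for u v a b
    proof -
      note uv = dom(1)[OF that(1)] dom(1)[OF that(2)]
      let ?w = "map ?I (rev u) @ map ?V v"
      note w = inverse_append_in_lists[OF S(3) uv]
      have "word_code c ?w \<in> word_code c ` word_problem G S \<longleftrightarrow> ?w \<in> word_problem G S"
        using inj_on_word_code[OF inj(1)] w
        by (subst inj_on_image_mem_iff[of _ "lists S"]) (auto simp: word_problem_def)
      then show ?thesis
        by (simp add: canonical_epi_eq_iff_word_problem[OF SG S(3) uv] D[OF uv] flip: R(2))
    qed
    have "n \<in> ?E \<longleftrightarrow> p \<in> forbidden_patterns S A (pullback G S (full_shift G A))"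
      using inj_on_pattern_code[OF inj] p
      by (simp add: p(2), subst inj_on_image_mem_iff[of _ "patterns S A"])
        (auto simp: forbidden_patterns_def)
    also have "\<dots> \<longleftrightarrow> (\<exists>u v a b. p u = Some a \<and> p v = Some b \<and> d a \<noteq> d b \<and>
        canonical_epi G u = canonical_epi G v)"
      using p(1) dom(2) inj(2)
      unfolding mem_forbidden_patterns_full_shift[OF SG A(2)] by (blast dest: inj_onD)
    also have "\<dots> \<longleftrightarrow> (\<exists>u v a b. p u = Some a \<and> p v = Some b \<and> d a \<noteq> d b \<and>
        (\<exists>j. R j (D (word_code ?k u) (word_code ?k v))))"
      using wp by (intro ex_cong1) blast
    also have "\<dots> \<longleftrightarrow> (\<exists>z z' j. Q z z' j n)"
    proof
      assume "\<exists>u v a b. p u = Some a \<and> p v = Some b \<and> d a \<noteq> d b \<and>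
        (\<exists>j. R j (D (word_code ?k u) (word_code ?k v)))"
      then obtain u v a b j where "p u = Some a" "p v = Some b" "d a \<noteq> d b"
        "R j (D (word_code ?k u) (word_code ?k v))" by blast
      then have "Q (prod_encode (word_code ?k u, d a)) (prod_encode (word_code ?k v, d b)) j n"
        using True by (auto simp: Q_def p(2) mem_set_decode_pattern_code[OF p(1)])
      then show "\<exists>z z' j. Q z z' j n" by blast
    next
      assume "\<exists>z z' j. Q z z' j n"
      then obtain z z' j where q: "Q z z' j n" by blast
      then obtain u a v b where uv: "p u = Some a" "z = prod_encode (word_code ?k u, d a)"
        "p v = Some b" "z' = prod_encode (word_code ?k v, d b)"
        by (auto simp: Q_def p(2) mem_set_decode_pattern_code[OF p(1)])
      with q have "d a \<noteq> d b" "R j (D (word_code ?k u) (word_code ?k v))"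
        by (auto simp: Q_def)
      with uv(1,3) show "\<exists>u v a b. p u = Some a \<and> p v = Some b \<and> d a \<noteq> d b \<and>
          (\<exists>j. R j (D (word_code ?k u) (word_code ?k v)))"
        by blast
    qed
    finally show ?thesis .
  qed (auto simp: Q_def forbidden_patterns_def)
  \<comment> \<open>Nested pairing packs the three witnesses into a single number, as a projection
    requires.\<close>
  then have "?E = {n. \<exists>k. Q (fst (prod_decode k)) (fst (prod_decode (snd (prod_decode k))))
      (snd (prod_decode (snd (prod_decode k)))) n}"
    by (auto simp: set_eq_iff) (metis fst_conv snd_conv prod_encode_inverse)
  moreover have "recursively_enumerable \<dots>"
    unfolding Q_def
    by (intro recursively_enumerable_projection decidable_intros decR compD computable_intros
        decidable_comp[OF decidable_pattern_codes[OF S(1) inj(1) A(1) inj(2)]])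
  ultimately have "recursively_enumerable ?E" by simp
  with c d have "effectively_closed S A (pullback G S (full_shift G A))"
    unfolding effectively_closed_def by blast
  then show ?thesis
    using S subshift_full_shift by (auto simp: effective_subshift_def)
qed

section \<open>From effectiveness to a recursive presentation\<close>

lemma recursively_presented_if_effective_full_shift:
  assumes A: "finite A" "card A \<ge> 2" and eff: "effective_subshift G A (full_shift G A)"
  shows "recursively_presented G"
proof -
  obtain S c d where S: "finite S" "generating_set G S" and c: "numbering S c"
    and d: "numbering A d" and re: "recursively_enumerable
      (pattern_code c d ` forbidden_patterns S A (pullback G S (full_shift G A)))"
    using eff by (auto simp: effective_subshift_def effectively_closed_def)
  have inj: "inj_on c S" "inj_on d A" using c d by (auto simp: numbering_def bij_betw_def)
  have SG: "S \<subseteq> carrier G" and gen: "generate G S = carrier G"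
    using S(2) by (auto simp: generating_set_def)
  obtain a b where ab: "a \<in> A" "b \<in> A" "a \<noteq> b"
    using A(2) card_le_Suc0_iff_eq[OF A(1)] by fastforce
  then have A0: "A \<noteq> {}" by blast
  let ?k = "letter_code c"
  \<comment> \<open>\<open>T\<close> consists of the elements of \<open>S\<close> and their
    inverses, which makes it symmetric.\<close>
  define T where "T = letter_value G ` (S \<times> UNIV)"
  have finT: "finite T" using S(1) by (simp add: T_def)
  have TG: "T \<subseteq> carrier G" using letter_value_closed[OF SG] by (auto simp: T_def)
  have ST: "S \<subseteq> T" by (force simp: T_def letter_value_def)
  have "generating_set G T"
    using TG gen mono_generate[OF ST] generate_incl[OF TG] by (auto simp: generating_set_def)
  have symT: "symmetric_set G T"
    unfolding symmetric_set_def
  proof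
    fix t assume "t \<in> T"
    then obtain x where x: "x \<in> S \<times> UNIV" "t = letter_value G x" by (auto simp: T_def)
    then have "inv t = letter_value G (inv_letter x)" "inv_letter x \<in> S \<times> UNIV"
      using SG by (cases x; auto simp: letter_value_def)+
    then show "inv t \<in> T" by (auto simp: T_def)
  qed
  obtain e where e: "numbering T e"
    using ex_bij_betw_finite_nat[OF finT] by (auto simp: numbering_def atLeast0LessThan)
  have inje: "inj_on e T" using e by (auto simp: numbering_def bij_betw_def)
  \<comment> \<open>Several formal letters may have the same value, for instance when a generator is
    an involution. Any choice works, since only the value of the lifted word in the group
    matters.\<close>
  define l where "l = inv_into (S \<times> UNIV) (letter_value G)"
  have l: "l t \<in> S \<times> UNIV" "letter_value G (l t) = t" if "t \<in> T" for t
    using that by (simp_all add: T_def l_def inv_into_into f_inv_into_f del: mem_Sigma_iff)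
  obtain L where L: "computable L" "\<And>t. t \<in> T \<Longrightarrow> L (e t) = ?k (l t)"
    using computable_finite_extension[OF finT inje, of "\<lambda>t. ?k (l t)"] by metis
  obtain red where red: "computable red"
    "\<And>w. w \<in> lists (S \<times> UNIV) \<Longrightarrow>
      red (word_code ?k w) = word_code ?k (foldr reduced_cons w [])"
    using computable_reduction[OF S(1) inj(1)] by metis
  define r where "r n = red (list_encode (map L (list_decode n)))" for n
  have compr: "computable (\<lambda>x. r (f x))" if "computable f" for f
    unfolding r_def by (intro computable_comp[OF red(1)] computable_map L(1) that)
  obtain R where R: "decidable (\<lambda>z. R (fst (prod_decode z)) (snd (prod_decode z)))"
    "\<And>n. n \<in> pattern_code c d ` forbidden_patterns S A (pullback G S (full_shift G A)) \<longleftrightarrow>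
      (\<exists>k. R k n)"
    by (rule recursively_enumerableE[OF re], rule that)
  have decR: "decidable (\<lambda>x. R (f x) (g x))" if "computable f" "computable g" for f g
    using decidable_comp[OF R(1) computable_prod_encode[OF that]] by simp
  \<comment> \<open>\<open>r n\<close> is the code of the reduced lift. If it is 0, the lift reduces
    to the empty word and the word represents the identity. Otherwise the sum of two powers of 2 is
    the code of the pattern with letter \<open>a\<close> at the reduced lift and \<open>b\<close> at
    the empty word, whose code is 0.\<close>
  define Q where "Q k n \<longleftrightarrow> n \<in> word_code e ` lists T \<and>
    (r n = 0 \<or> R k (2 ^ prod_encode (r n, d a) + 2 ^ prod_encode (0, d b)))" for k n
  have wp: "w \<in> word_problem G T \<longleftrightarrow> (\<exists>k. Q k (word_code e w))" if w: "w \<in> lists T" for w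
  proof -
    let ?u = "map l w"
    let ?v = "foldr reduced_cons ?u []"
    have u: "?u \<in> lists (S \<times> UNIV)" using w l(1) by (rule map_in_lists)
    have v: "?v \<in> carrier (free_group S)"
      using foldr_reduced_cons_lists[OF u, of "[]"] reduced_foldr[of "[]" ?u]
      by (simp add: free_group_def)
    have "map L (map e w) = map ?k ?u" using w L(2) by auto
    then have r: "r (word_code e w) = word_code ?k ?v"
      using red(2)[OF u] by (simp only: r_def word_code_def list_encode_inverse)
    have "map (letter_value G) ?u = w" using w l(2) by (auto simp: map_idI)
    then have "word_value G w = canonical_epi G ?u"
      by (simp only: canonical_epi_def)
    then have "word_value G w = canonical_epi G ?v"
      by (simp only: canonical_epi_reduce[OF SG u])
    then have iff: "w \<in> word_problem G T \<longleftrightarrow> canonical_epi G ?v = \<one>"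
      using w by (simp add: word_problem_def)
    show ?thesis
    proof (cases "?v = []")
      case True
      then show ?thesis using iff r w by (auto simp: Q_def canonical_epi_Nil)
    next
      case False
      let ?p = "[?v \<mapsto> a, [] \<mapsto> b]"
      have "[] \<in> carrier (free_group S)" by (simp add: free_group_def)
      then have p: "?p \<in> patterns S A"
        using v ab False by (auto simp: patterns_def ran_def split: if_splits)
      have "Map.graph ?p = {(?v, a), ([], b)}"
        using False by (auto simp: Map.graph_def split: if_splits)
      \<comment> \<open>This separates the two exponents, so that the sum of powers is the code of a
        set with two elements.\<close>
      moreover have "word_code ?k ?v \<noteq> 0" using False by (cases ?v) auto
      ultimately have code: "pattern_code c d ?p =
          2 ^ prod_encode (word_code ?k ?v, d a) + 2 ^ prod_encode (0, d b)"
        by (simp add: pattern_code_def set_encode_def word_code_def)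
      have "(\<exists>u v x y. ?p u = Some x \<and> ?p v = Some y \<and> x \<noteq> y \<and>
          canonical_epi G u = canonical_epi G v) \<longleftrightarrow> canonical_epi G ?v = \<one>"
      proof
        assume "\<exists>u v x y. ?p u = Some x \<and> ?p v = Some y \<and> x \<noteq> y \<and>
          canonical_epi G u = canonical_epi G v"
        then obtain u v x y where "?p u = Some x" "?p v = Some y" "x \<noteq> y"
          "canonical_epi G u = canonical_epi G v" by blast
        then show "canonical_epi G ?v = \<one>"
          by (auto simp: canonical_epi_Nil split: if_splits)
      next
        assume "canonical_epi G ?v = \<one>"
        then show "\<exists>u v x y. ?p u = Some x \<and> ?p v = Some y \<and> x \<noteq> y \<and>
          canonical_epi G u = canonical_epi G v"
          using False ab(3)
          by (intro exI[of _ ?v] exI[of _ "[]"] exI[of _ a] exI[of _ b]) (simp add: canonical_epi_Nil)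
      qed
      with p have "w \<in> word_problem G T \<longleftrightarrow>
          ?p \<in> forbidden_patterns S A (pullback G S (full_shift G A))"
        by (simp only: iff mem_forbidden_patterns_full_shift[OF SG A0] simp_thms)
      also have "\<dots> \<longleftrightarrow> pattern_code c d ?p \<in>
          pattern_code c d ` forbidden_patterns S A (pullback G S (full_shift G A))"
        using inj_on_pattern_code[OF inj] p
        by (subst inj_on_image_mem_iff[of _ "patterns S A"]) (auto simp: forbidden_patterns_def)
      also have "\<dots> \<longleftrightarrow> (\<exists>k. Q k (word_code e w))"
        using w False \<open>word_code ?k ?v \<noteq> 0\<close> by (simp add: R(2) code Q_def r)
      finally show ?thesis .
    qed
  qed
  have codes: "decidable (\<lambda>x. f x \<in> word_code e ` lists T)" if "computable f" for f
    using decidable_coded_lists[OF finT that, of e] by (simp add: word_code_def)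
  have "word_code e ` word_problem G T = {n. \<exists>k. Q k n}"
  proof (rule Set.set_eqI, rule iffI)
    fix n assume "n \<in> word_code e ` word_problem G T"
    then obtain w where "n = word_code e w" "w \<in> word_problem G T" by blast
    moreover from this have "w \<in> lists T" by (simp add: word_problem_def)
    ultimately show "n \<in> {n. \<exists>k. Q k n}" using wp by simp
  next
    fix n assume n: "n \<in> {n. \<exists>k. Q k n}"
    then obtain w where "w \<in> lists T" "n = word_code e w" by (auto simp: Q_def)
    with n wp[of w] show "n \<in> word_code e ` word_problem G T" by auto
  qed
  moreover have "recursively_enumerable {n. \<exists>k. Q k n}"
    unfolding Q_def
    by (intro recursively_enumerable_projection decidable_intros codes decR compr computable_intros)
  ultimately have "re_language T (word_problem G T)"
    using e by (auto simp: re_language_def word_code_def)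
  then show ?thesis
    using finT \<open>generating_set G T\<close> symT by (auto simp: recursively_presented_def)
qed

end

theorem proposition7p9:
  fixes G :: "('g, 'm) monoid_scheme" and A :: "'a set"
  assumes "finite A" and "card A \<ge> 2"
    and "group G" and "finitely_generated G"
  shows "effective_subshift G A (full_shift G A) \<longleftrightarrow> recursively_presented G"
proof -
  have "A \<noteq> {}" using assms(2) by auto
  with assms show ?thesis
    using group.recursively_presented_if_effective_full_shift[of G A]
      group.effective_full_shift_if_recursively_presented[of G A] by blast
qed

end
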